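(* Let $S=\{0\}\cup\{x\in\mathbb{N}^2\mid x\succeq_{glex}c\}$, for some $c\in\mathbb{N}^2$, be an ordinary $\mathbb{N}^2$-semigroup, ordered by $\preceq_{glex}$. Then $S$ satisfies the Generalized Wilf Conjecture, i.e. $$\nu(S)\,\mathrm{e}(S)\geq 2\,\gamma(S),$$ and, if $S\neq\mathbb{N}^2$, $S$ satisfies the Extended Wilf Conjecture, i.e. $$\mathrm{n}(S)\,\mathrm{e}(S)\geq\mathcal{N}(\mathrm{Fb}(S))+1.$$
   Context: $\mathbb{N}$ contains $0$. The graded lexicographic order on $\mathbb{N}^2$ is: $x\prec_{glex}y$ iff $x_1+x_2<y_1+y_2$, or $x_1+x_2=y_1+y_2$ and $x_1<y_1$. For a submonoid $S\subseteq\mathbb{N}^2$ with finite gap set $\mathcal{H}(S)=\mathbb{N}^2\setminus S$: $\mathrm{e}(S)$ is the cardinality of its unique minimal system of generators; $\nu(S)=\sharp\{x\in S\mid x\leq h\text{ for some }h\in\mathcal{H}(S)\}$ and $\gamma(S)=\sharp\{x\in\mathbb{N}^2\mid x\leq h\text{ for some }h\in\mathcal{H}(S)\}$, where $\leq$ is the componentwise order and $\sharp$ denotes cardinality; for $S\neq\mathbb{N}^2$, $\mathrm{Fb}(S)=\max_{\preceq_{glex}}\mathcal{H}(S)$, $\mathrm{n}(S)=\sharp\{s\in S\mid s\prec_{glex}\mathrm{Fb}(S)\}$, and $\mathcal{N}(\mathrm{Fb}(S))=\sharp\{x\in\mathbb{N}^2\setminus\{0\}\mid x\preceq_{glex}\mathrm{Fb}(S)\}$.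 *)

theory Defs
  imports "HOL.Hull" "HOL-Library.Product_Plus" "HOL-Library.Product_Order"
begin

text \<open>
  Elements of \<open>\<nat>\<^sup>2\<close> are pairs of type \<^typ>\<open>nat \<times> nat\<close>. Addition and zero are componentwise
  (\<^theory>\<open>HOL-Library.Product_Plus\<close>), and \<open>\<le>\<close> is the componentwise order
  (\<^theory>\<open>HOL-Library.Product_Order\<close>), not a lexicographic one.
\<close>

definition glex_less :: "nat \<times> nat \<Rightarrow> nat \<times> nat \<Rightarrow> bool"  (infix "\<prec>\<^sub>g" 50)
  where "x \<prec>\<^sub>g y \<longleftrightarrow>
    fst x + snd x < fst y + snd y \<or> (fst x + snd x = fst y + snd y \<and> fst x < fst y)"

definition glex_le :: "nat \<times> nat \<Rightarrow> nat \<times> nat \<Rightarrow> bool"  (infix "\<preceq>\<^sub>g" 50)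
  where "x \<preceq>\<^sub>g y \<longleftrightarrow> x \<prec>\<^sub>g y \<or> x = y"

definition submonoid :: "(nat \<times> nat) set \<Rightarrow> bool"
  where "submonoid S \<longleftrightarrow> 0 \<in> S \<and> (\<forall>x\<in>S. \<forall>y\<in>S. x + y \<in> S)"

definition minimal_generators :: "(nat \<times> nat) set \<Rightarrow> (nat \<times> nat) set \<Rightarrow> bool"
  where "minimal_generators S A \<longleftrightarrow>
    submonoid hull A = S \<and> (\<forall>B. B \<subset> A \<longrightarrow> submonoid hull B \<noteq> S)"

text \<open>The minimal system of generators of a submonoid of \<open>\<nat>\<^sup>2\<close> is unique, so \<open>THE\<close> is meaningful.\<close>

definition embedding_dim :: "(nat \<times> nat) set \<Rightarrow> nat"
  where "embedding_dim S = card (THE A. minimal_generators S A)"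

definition gaps :: "(nat \<times> nat) set \<Rightarrow> (nat \<times> nat) set"
  where "gaps S = UNIV - S"

definition wilf_nu :: "(nat \<times> nat) set \<Rightarrow> nat"
  where "wilf_nu S = card {x \<in> S. \<exists>h\<in>gaps S. x \<le> h}"

definition wilf_gamma :: "(nat \<times> nat) set \<Rightarrow> nat"
  where "wilf_gamma S = card {x. \<exists>h\<in>gaps S. x \<le> h}"

text \<open>The maximum exists when \<open>gaps S\<close> is finite and nonempty; otherwise the value is unspecified.\<close>

definition Frob :: "(nat \<times> nat) set \<Rightarrow> nat \<times> nat"
  where "Frob S = (THE h. h \<in> gaps S \<and> (\<forall>g\<in>gaps S. g \<preceq>\<^sub>g h))"

definition wilf_n :: "(nat \<times> nat) set \<Rightarrow> nat"
  where "wilf_n S = card {s \<in> S. s \<prec>\<^sub>g Frob S}"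

definition glex_count :: "nat \<times> nat \<Rightarrow> nat"
  where "glex_count y = card {x. x \<noteq> 0 \<and> x \<preceq>\<^sub>g y}"

definition ordinary :: "nat \<times> nat \<Rightarrow> (nat \<times> nat) set"
  where "ordinary c = {0} \<union> {x. c \<preceq>\<^sub>g x}"

end

theory Submission
  imports Defs
begin

text \<open>
  Let \<open>c = (a, b)\<close>, \<open>d = a + b\<close> and \<open>L = {x. x \<prec>\<^sub>g c}\<close>. A point of \<open>S\<close> below a gap precedes \<open>c\<close>, so
  it is \<open>0\<close>; hence \<open>\<nu>(S) = n(S) = 1\<close> and both inequalities follow from \<open>e(S) \<ge> 2 |L|\<close>. The minimal
  generators are the irreducible elements of \<open>S\<close>. Among these are all points of \<open>S\<close> before \<open>2c\<close>, and
  moreover the \<open>a\<close> points of degree \<open>2d + 1\<close> with first coordinate less than \<open>a\<close>: a decomposition of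
  such a point has a summand of degree \<open>d\<close>, whose first coordinate is at least \<open>a\<close>. Counting,
  \<open>|L| + e(S) \<ge> d(2d + 1) + 3a\<close> while \<open>3 |L| = 3d(d + 1)/2 + 3a\<close>, and \<open>d\<^sup>2 \<ge> d\<close>.
\<close>

section \<open>Irreducible elements as the minimal system of generators\<close>

definition irreducibles :: "(nat \<times> nat) set \<Rightarrow> (nat \<times> nat) set"
  where "irreducibles S = {x \<in> S. x \<noteq> 0 \<and> (\<forall>y\<in>S. \<forall>z\<in>S. x = y + z \<longrightarrow> y = 0 \<or> z = 0)}"

lemma submonoid_hull: "submonoid (submonoid hull A)"
  by (auto simp: submonoid_def hull_def)

lemma submonoid_remove_irreducible:
  assumes "submonoid S" "x \<in> irreducibles S"
  shows "submonoid (S - {x})"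
  unfolding submonoid_def
proof (intro conjI ballI)
  show "0 \<in> S - {x}"
    using assms by (auto simp: submonoid_def irreducibles_def)
next
  fix y z assume yz: "y \<in> S - {x}" "z \<in> S - {x}"
  then have "y + z \<noteq> x"
    using assms(2) by (auto simp: irreducibles_def)
  then show "y + z \<in> S - {x}"
    using assms(1) yz by (auto simp: submonoid_def)
qed

text \<open>If \<open>A\<close> missed an irreducible \<open>x\<close>, then \<open>S - {x}\<close>
  would be a submonoid containing \<open>A\<close>, hence containing the whole hull
  \<open>S\<close>.\<close>

lemma irreducibles_subset_generators:
  assumes "submonoid hull A = S"
  shows "irreducibles S \<subseteq> A"
proof
  fix x assume x: "x \<in> irreducibles S"
  show "x \<in> A"
  proof (rule ccontr)
    assume "x \<notin> A"
    then have "A \<subseteq> S - {x}"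
      using hull_subset[of A submonoid] assms by auto
    moreover have "submonoid (S - {x})"
      using submonoid_hull[of A] assms x by (intro submonoid_remove_irreducible) auto
    ultimately have "S \<subseteq> S - {x}"
      using hull_minimal[of A "S - {x}" submonoid] assms by simp
    with x show False
      by (auto simp: irreducibles_def)
  qed
qed

text \<open>Induction on the degree: a reducible element splits into two nonzero summands, both of
  smaller degree.\<close>

lemma hull_irreducibles:
  assumes "submonoid S"
  shows "submonoid hull (irreducibles S) = S"
proof (rule antisym)
  show "submonoid hull irreducibles S \<subseteq> S"
    using assms by (intro hull_minimal) (auto simp: irreducibles_def)
  have closed: "0 \<in> submonoid hull irreducibles S"
    "\<And>y z. y \<in> submonoid hull irreducibles S \<Longrightarrow> z \<in> submonoid hull irreducibles S
      \<Longrightarrow> y + z \<in> submonoid hull irreducibles S"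
    using submonoid_hull[of "irreducibles S"] by (auto simp: submonoid_def)
  have "x \<in> S \<longrightarrow> x \<in> submonoid hull irreducibles S" for x
  proof (induction x rule: measure_induct_rule[where f = "\<lambda>x. fst x + snd x"])
    case (less x)
    show ?case
    proof (intro impI)
      assume "x \<in> S"
      consider "x = 0" | "x \<in> irreducibles S"
        | y z where "x = y + z" "y \<in> S" "z \<in> S" "y \<noteq> 0" "z \<noteq> 0"
        using \<open>x \<in> S\<close> unfolding irreducibles_def by blast
      then show "x \<in> submonoid hull irreducibles S"
      proof cases
        case 1
        then show ?thesis using closed by simp
      next
        case 2
        then show ?thesis by (rule hull_inc)
      next
        case 3
        then have "fst y + snd y < fst x + snd x" "fst z + snd z < fst x + snd x"
          by (auto simp: prod_eq_iff)
        then have "y \<in> submonoid hull irreducibles S" "z \<in> submonoid hull irreducibles S"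
          using 3 less.IH by blast+
        then show ?thesis
          unfolding \<open>x = y + z\<close> by (rule closed)
      qed
    qed
  qed
  then show "S \<subseteq> submonoid hull irreducibles S"
    by blast
qed

lemma embedding_dim_eq:
  assumes "submonoid S"
  shows "embedding_dim S = card (irreducibles S)"
proof -
  have "(THE A. minimal_generators S A) = irreducibles S"
  proof (rule the_equality)
    show "minimal_generators S (irreducibles S)"
      using hull_irreducibles[OF assms] irreducibles_subset_generators
      unfolding minimal_generators_def by blast
  next
    fix A assume "minimal_generators S A"
    then have "submonoid hull A = S" "\<not> irreducibles S \<subset> A"
      using hull_irreducibles[OF assms] by (auto simp: minimal_generators_def)
    with irreducibles_subset_generators[of A S] show "A = irreducibles S"
      by blast
  qed
  then show ?thesis
    by (simp add: embedding_dim_def)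
qed

section \<open>The graded lexicographic order and ordinary semigroups\<close>

lemma glex_le_trans: "x \<preceq>\<^sub>g y \<Longrightarrow> y \<preceq>\<^sub>g z \<Longrightarrow> x \<preceq>\<^sub>g z"
  unfolding glex_le_def by (elim disjE) (auto simp: glex_less_def)

lemma glex_le_antisym: "x \<preceq>\<^sub>g y \<Longrightarrow> y \<preceq>\<^sub>g x \<Longrightarrow> x = y"
  unfolding glex_le_def by (elim disjE) (auto simp: glex_less_def)

lemma not_glex_less_iff: "\<not> x \<prec>\<^sub>g y \<longleftrightarrow> y \<preceq>\<^sub>g x"
  by (cases x; cases y) (auto simp: glex_le_def glex_less_def)

lemma submonoid_ordinary: "submonoid (ordinary c)"
proof -
  have "x + y \<in> ordinary c" if "x \<in> ordinary c" "y \<in> ordinary c" for x y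
  proof (cases "x = 0 \<or> y = 0")
    case True
    with that show ?thesis by auto
  next
    case False
    with that have "c \<preceq>\<^sub>g x"
      by (simp add: ordinary_def)
    moreover have "x \<preceq>\<^sub>g x + y"
      using False by (auto simp: glex_le_def glex_less_def prod_eq_iff)
    ultimately show ?thesis
      using glex_le_trans by (auto simp: ordinary_def)
  qed
  then show ?thesis
    by (simp add: submonoid_def ordinary_def)
qed

lemma finite_degree_le: "finite {x :: nat \<times> nat. fst x + snd x \<le> n}"
  by (rule finite_subset[of _ "{..n} \<times> {..n}"]) auto

text \<open>Every point of degree above \<open>a + b\<close> lies in the semigroup, so a point of
  degree at least \<open>2 * (a + b) + 2\<close> splits into two such points. This yields the
  finiteness without which \<open>card\<close> would be 0.\<close>

lemma irreducibles_ordinary_degree: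
  assumes "x \<in> irreducibles (ordinary (a, b))"
  shows "fst x + snd x \<le> 2 * (a + b) + 1"
proof (rule ccontr)
  assume large: "\<not> ?thesis"
  \<comment> \<open>\<open>y\<close> takes as much of its degree \<open>a + b + 1\<close> as
    possible from the first coordinate; the rest fits into \<open>snd x\<close>, so the truncated
    subtractions in \<open>z\<close> are exact.\<close>
  define i where "i = min (fst x) (a + b + 1)"
  define y where "y = (i, a + b + 1 - i)"
  define z where "z = (fst x - i, snd x - (a + b + 1 - i))"
  have "x = y + z" "fst y + snd y = a + b + 1" "fst z + snd z \<ge> a + b + 1"
    using large by (auto simp: y_def z_def i_def prod_eq_iff)
  then have "x = y + z" "y \<in> ordinary (a, b)" "z \<in> ordinary (a, b)" "y \<noteq> 0" "z \<noteq> 0"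
    by (auto simp: ordinary_def glex_le_def glex_less_def)
  with assms show False
    by (auto simp: irreducibles_def)
qed

lemma finite_irreducibles_ordinary: "finite (irreducibles (ordinary c))"
  using finite_subset[OF _ finite_degree_le] irreducibles_ordinary_degree
  by (cases c) blast

section \<open>Counting points by degree\<close>

lemma card_degree_eq:
  assumes "m \<le> n + 1"
  shows "finite {x :: nat \<times> nat. fst x + snd x = n \<and> fst x < m}"
    and "card {x :: nat \<times> nat. fst x + snd x = n \<and> fst x < m} = m"
proof -
  have "{x :: nat \<times> nat. fst x + snd x = n \<and> fst x < m} = (\<lambda>i. (i, n - i)) ` {..<m}"
    using assms by (auto simp: image_iff)
  then show "finite {x :: nat \<times> nat. fst x + snd x = n \<and> fst x < m}"
    and "card {x :: nat \<times> nat. fst x + snd x = n \<and> fst x < m} = m"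
    by (auto simp: card_image inj_on_def)
qed

lemma finite_degree_less: "finite {x :: nat \<times> nat. fst x + snd x < n}"
  by (rule finite_subset[OF _ finite_degree_le[of n]]) auto

lemma card_degree_less: "2 * card {x :: nat \<times> nat. fst x + snd x < n} = n * (n + 1)"
proof (induction n)
  case (Suc n)
  \<comment> \<open>The bound \<open>fst x < n + 1\<close> holds on all of degree \<open>n\<close>,
    which puts the full diagonal into the form of \<open>card_degree_eq\<close>.\<close>
  have "{x :: nat \<times> nat. fst x + snd x < Suc n}
    = {x. fst x + snd x < n} \<union> {x. fst x + snd x = n \<and> fst x < n + 1}"
    by auto
  then have "card {x :: nat \<times> nat. fst x + snd x < Suc n}
    = card {x :: nat \<times> nat. fst x + snd x < n} + (n + 1)"
    using card_Un_disjoint[OF finite_degree_less[of n] card_degree_eq(1)[of "n + 1" n]]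
      card_degree_eq(2)[of "n + 1" n] by auto
  with Suc show ?case
    by simp
qed simp

lemma finite_glex_less: "finite {x. x \<prec>\<^sub>g c}"
  by (rule finite_subset[OF _ finite_degree_le[of "fst c + snd c"]]) (auto simp: glex_less_def)

lemma card_glex_less:
  "2 * card {x. x \<prec>\<^sub>g (a, b)} = (a + b) * (a + b + 1) + 2 * a"
proof -
  have "{x. x \<prec>\<^sub>g (a, b)}
    = {x. fst x + snd x < a + b} \<union> {x. fst x + snd x = a + b \<and> fst x < a}"
    by (auto simp: glex_less_def)
  moreover have "{x :: nat \<times> nat. fst x + snd x < a + b}
    \<inter> {x. fst x + snd x = a + b \<and> fst x < a} = {}"
    by auto
  ultimately have "card {x. x \<prec>\<^sub>g (a, b)} = card {x :: nat \<times> nat. fst x + snd x < a + b} + a"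
    using card_Un_disjoint[OF finite_degree_less[of "a + b"] card_degree_eq(1)[of a "a + b"]]
      card_degree_eq(2)[of a "a + b"] by simp
  then show ?thesis
    using card_degree_less[of "a + b"] by simp
qed

section \<open>Lower bound for the number of irreducibles\<close>

lemma ordinary_nonzeroD:
  assumes "y \<in> ordinary (a, b)" "y \<noteq> 0"
  shows "a + b < fst y + snd y \<or> (fst y + snd y = a + b \<and> a \<le> fst y)"
  using assms by (cases y) (auto simp: ordinary_def glex_le_def glex_less_def)

text \<open>Nonzero summands have degree at least \<open>a + b\<close>. A sum of degree
  \<open>2 * (a + b)\<close> forces both to have degree \<open>a + b\<close>, hence first coordinate
  at least \<open>2 * a\<close> in total; one more degree still forces one of them, hence at least
  \<open>a\<close>.\<close>

lemma irreducibles_ordinaryI: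
  assumes "(a, b) \<preceq>\<^sub>g x" "x \<noteq> 0"
    and "fst x + snd x < 2 * (a + b) \<or> (fst x + snd x = 2 * (a + b) \<and> fst x < 2 * a)
      \<or> (fst x + snd x = 2 * (a + b) + 1 \<and> fst x < a)"
  shows "x \<in> irreducibles (ordinary (a, b))"
proof -
  have "y = 0 \<or> z = 0"
    if yz: "y \<in> ordinary (a, b)" "z \<in> ordinary (a, b)" "x = y + z" for y z
  proof (rule ccontr)
    assume "\<not> ?thesis"
    then have "y \<noteq> 0" "z \<noteq> 0" by simp_all
    have "fst x = fst y + fst z" "snd x = snd y + snd z"
      using yz(3) by simp_all
    then show False
      using ordinary_nonzeroD[OF yz(1) \<open>y \<noteq> 0\<close>] ordinary_nonzeroD[OF yz(2) \<open>z \<noteq> 0\<close>] assms(3)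
      by auto
  qed
  moreover have "x \<in> ordinary (a, b)"
    using assms(1) by (simp add: ordinary_def)
  ultimately show ?thesis
    using assms(2) by (simp add: irreducibles_def)
qed

lemma card_irreducibles_ordinary:
  "2 * card {x. x \<prec>\<^sub>g c} \<le> card (irreducibles (ordinary c))"
proof -
  obtain a b where c: "c = (a, b)" by (cases c)
  define d where "d = a + b"
  let ?L = "{x. x \<prec>\<^sub>g (a, b)}" and ?I = "irreducibles (ordinary (a, b))"
  let ?M = "{x. x \<prec>\<^sub>g (2 * a, 2 * b)}"
  let ?E = "{x :: nat \<times> nat. fst x + snd x = 2 * d + 1 \<and> fst x < a}"
  have E: "finite ?E" "card ?E = a"
    using card_degree_eq[of a "2 * d + 1"] by (auto simp: d_def)
  have "?M \<inter> ?E = {}"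
    by (auto simp: glex_less_def d_def)
  then have "card ?M + a = card (?M \<union> ?E)"
    using E finite_glex_less by (simp add: card_Un_disjoint)
  also have "?M \<union> ?E \<subseteq> ?L \<union> ?I"
  proof
    fix x assume x: "x \<in> ?M \<union> ?E"
    have "x \<in> ?I" if "x \<notin> ?L"
    proof (rule irreducibles_ordinaryI)
      show "(a, b) \<preceq>\<^sub>g x"
        using that by (simp add: not_glex_less_iff)
      \<comment> \<open>If \<open>a + b > 0\<close>, then 0 is in \<open>?L\<close>; if
        \<open>a + b = 0\<close>, both \<open>?M\<close> and \<open>?E\<close> are empty.\<close>
      show "x \<noteq> 0"
        using that x by (cases "a + b = 0") (auto simp: glex_less_def d_def)
      show "fst x + snd x < 2 * (a + b) \<or> (fst x + snd x = 2 * (a + b) \<and> fst x < 2 * a)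
          \<or> (fst x + snd x = 2 * (a + b) + 1 \<and> fst x < a)"
        using x by (auto simp: glex_less_def d_def)
    qed
    then show "x \<in> ?L \<union> ?I" by blast
  qed
  then have "card (?M \<union> ?E) \<le> card (?L \<union> ?I)"
    by (intro card_mono) (auto simp: finite_glex_less finite_irreducibles_ordinary)
  also have "\<dots> \<le> card ?L + card ?I"
    by (rule card_Un_le)
  finally have "card ?M + a \<le> card ?L + card ?I" .
  moreover have "2 * card ?L = d * d + d + 2 * a"
    using card_glex_less[of a b] by (simp add: d_def algebra_simps)
  moreover have "2 * card ?M = 4 * (d * d) + 2 * d + 4 * a"
    using card_glex_less[of "2 * a" "2 * b"] by (simp add: d_def algebra_simps)
  \<comment> \<open>After doubling, the claim \<open>3 * card ?L \<le> card ?M + a\<close> reads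
    \<open>3 * d * d + 3 * d + 6 * a \<le> 4 * d * d + 2 * d + 6 * a\<close>; the points of
    \<open>?E\<close> balance the terms in \<open>a\<close>.\<close>
  moreover have "d \<le> d * d"
    by (cases d) auto
  ultimately show ?thesis
    unfolding c by linarith
qed

section \<open>Gaps and the Frobenius element\<close>

lemma ex_glex_greatest:
  assumes "finite A" "A \<noteq> {}"
  shows "\<exists>h\<in>A. \<forall>g\<in>A. g \<preceq>\<^sub>g h"
  using assms
proof (induction rule: finite_ne_induct)
  case (insert x A)
  then obtain h where h: "h \<in> A" "\<forall>g\<in>A. g \<preceq>\<^sub>g h" by blast
  have "x \<preceq>\<^sub>g h \<or> h \<preceq>\<^sub>g x"
    using not_glex_less_iff[of x h] by (auto simp: glex_le_def)
  then show ?case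
  proof
    assume "x \<preceq>\<^sub>g h"
    with h show ?thesis by blast
  next
    assume "h \<preceq>\<^sub>g x"
    then have "\<forall>g\<in>insert x A. g \<preceq>\<^sub>g x"
      using h(2) glex_le_trans glex_le_def[of x x] by blast
    then show ?thesis by blast
  qed
qed (simp add: glex_le_def)

lemma Frob_in_gaps:
  assumes "finite (gaps S)" "gaps S \<noteq> {}"
  shows "Frob S \<in> gaps S"
proof -
  obtain h where h: "h \<in> gaps S" "\<forall>g\<in>gaps S. g \<preceq>\<^sub>g h"
    using ex_glex_greatest[OF assms] by blast
  have "Frob S = h"
    unfolding Frob_def
  proof (rule the_equality)
    show "h \<in> gaps S \<and> (\<forall>g\<in>gaps S. g \<preceq>\<^sub>g h)"
      using h by blast
  next
    fix h' assume "h' \<in> gaps S \<and> (\<forall>g\<in>gaps S. g \<preceq>\<^sub>g h')"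
    with h show "h' = h"
      by (blast intro: glex_le_antisym)
  qed
  with h show ?thesis by simp
qed

lemma gaps_ordinary: "gaps (ordinary c) = {x. x \<prec>\<^sub>g c} - {0}"
  by (auto simp: gaps_def ordinary_def not_glex_less_iff[symmetric])

text \<open>A point componentwise below \<open>h\<close> is \<open>h\<close> itself or has smaller
  degree.\<close>

lemma glex_less_if_le: "x \<le> h \<Longrightarrow> h \<prec>\<^sub>g c \<Longrightarrow> x \<prec>\<^sub>g c"
  by (auto simp: glex_less_def less_eq_prod_def)

lemma glex_less_if_glex_le: "x \<preceq>\<^sub>g h \<Longrightarrow> h \<prec>\<^sub>g c \<Longrightarrow> x \<prec>\<^sub>g c"
  by (auto simp: glex_less_def glex_le_def)

lemma zero_glex_less: "x \<noteq> 0 \<Longrightarrow> 0 \<prec>\<^sub>g x"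
  by (auto simp: glex_less_def prod_eq_iff)

theorem corollary35:
  fixes c :: "nat \<times> nat" and S :: "(nat \<times> nat) set"
  assumes "S = ordinary c"
  shows "wilf_nu S * embedding_dim S \<ge> 2 * wilf_gamma S \<and>
         (S \<noteq> UNIV \<longrightarrow> wilf_n S * embedding_dim S \<ge> glex_count (Frob S) + 1)"
proof (cases "gaps S = {}")
  case True
  then have "wilf_gamma S = 0" "S = UNIV"
    by (auto simp: wilf_gamma_def) (auto simp: gaps_def)
  then show ?thesis by simp
next
  case False
  let ?L = "{x. x \<prec>\<^sub>g c}"
  have gaps: "gaps S = ?L - {0}"
    using assms gaps_ordinary by simp
  have edim: "2 * card ?L \<le> embedding_dim S"
    using card_irreducibles_ordinary embedding_dim_eq[OF submonoid_ordinary] assms by simp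
  have below: "{x. \<exists>h\<in>gaps S. x \<le> h} \<subseteq> ?L"
    using gaps glex_less_if_le by blast
  then have gamma: "wilf_gamma S \<le> card ?L"
    unfolding wilf_gamma_def by (intro card_mono finite_glex_less)
  have "0 \<in> S"
    using assms by (simp add: ordinary_def)
  have "finite {x \<in> S. \<exists>h\<in>gaps S. x \<le> h}"
    by (rule finite_subset[OF _ finite_glex_less[of c]]) (use below in blast)
  \<comment> \<open>The bound \<open>1 \<le> wilf_nu S\<close> suffices, and 0 lies below every
    gap.\<close>
  moreover have "0 \<in> {x \<in> S. \<exists>h\<in>gaps S. x \<le> h}"
    using False \<open>0 \<in> S\<close> by (auto simp: less_eq_prod_def)
  ultimately have nu: "1 \<le> wilf_nu S"
    unfolding wilf_nu_def by (metis Suc_leI One_nat_def card_gt_0_iff empty_iff)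
  have Frob: "Frob S \<prec>\<^sub>g c" "Frob S \<noteq> 0"
    using Frob_in_gaps[of S] False gaps finite_glex_less[of c] by auto
  have "0 \<in> {s \<in> S. s \<prec>\<^sub>g Frob S}"
    using Frob \<open>0 \<in> S\<close> by (simp add: zero_glex_less)
  moreover have "finite {s \<in> S. s \<prec>\<^sub>g Frob S}"
    using finite_glex_less by simp
  ultimately have n: "1 \<le> wilf_n S"
    unfolding wilf_n_def by (metis Suc_leI One_nat_def card_gt_0_iff empty_iff)
  \<comment> \<open>The point 0, left out by \<open>glex_count\<close>, supplies the summand 1 of
    the extended inequality.\<close>
  have "insert 0 {x. x \<noteq> 0 \<and> x \<preceq>\<^sub>g Frob S} \<subseteq> ?L"
    using Frob glex_less_if_glex_le[of _ "Frob S" c] glex_less_if_le[of 0 "Frob S" c]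
    by (auto simp: less_eq_prod_def)
  then have "card (insert 0 {x. x \<noteq> 0 \<and> x \<preceq>\<^sub>g Frob S}) \<le> card ?L"
    and "finite {x. x \<noteq> 0 \<and> x \<preceq>\<^sub>g Frob S}"
    using finite_glex_less[of c] by (auto intro: card_mono finite_subset)
  then have count: "glex_count (Frob S) + 1 \<le> card ?L"
    by (simp add: glex_count_def)
  have "embedding_dim S \<le> wilf_nu S * embedding_dim S"
    "embedding_dim S \<le> wilf_n S * embedding_dim S"
    using nu n by simp_all
  with edim gamma count show ?thesis
    by linarith
qed

end
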